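(* There exists a non-adaptive deterministic algorithm that solves the Graph Reconstruction problem with a CC oracle using $\mathcal{O}\big(\Delta^3 \log(n/\Delta)\big)$ CC queries when the maximum degree $\Delta$ of the hidden graph is known, where $n$ is the number of vertices.
   Context: Graph Reconstruction (GR): an unknown ("hidden") simple undirected graph $G=(V,E)$ on a known vertex set $V$ with $|V|=n$ is to be determined, i.e. the algorithm must output $E$. A CC oracle, on query $S\subseteq V$, returns the partition of $S$ into the vertex sets of the connected components of the induced subgraph $G[S]$; complexity is the number of queries. A non-adaptive algorithm fixes all its queries before seeing any answer; a deterministic algorithm must always output the hidden graph. *)

theory Defs
  imports Complex_Main
begin

text \<open>A graph is given by its vertex set and its set of edges, each edge being an unordered pair
  of distinct vertices.\<close>

definition simple_graph :: "'a set \<Rightarrow> 'a set set \<Rightarrow> bool" where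
  "simple_graph V E \<longleftrightarrow> finite V \<and> (\<forall>e\<in>E. e \<subseteq> V \<and> card e = 2)"

definition vertex_degree :: "'a set set \<Rightarrow> 'a \<Rightarrow> nat" where
  "vertex_degree E v = card {e \<in> E. v \<in> e}"

text \<open>Meaningful for finite nonempty \<open>V\<close> only.\<close>

definition max_degree :: "'a set \<Rightarrow> 'a set set \<Rightarrow> nat" where
  "max_degree V E = Max (vertex_degree E ` V)"

definition induced_adj :: "'a set set \<Rightarrow> 'a set \<Rightarrow> ('a \<times> 'a) set" where
  "induced_adj E S = {(u, v). u \<in> S \<and> v \<in> S \<and> {u, v} \<in> E}"

definition induced_connected :: "'a set set \<Rightarrow> 'a set \<Rightarrow> ('a \<times> 'a) set" where
  "induced_connected E S = {(u, v). u \<in> S \<and> v \<in> S \<and> (u, v) \<in> (induced_adj E S)\<^sup>*}"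

definition cc_oracle :: "'a set set \<Rightarrow> 'a set \<Rightarrow> 'a set set" where
  "cc_oracle E S = S // induced_connected E S"

text \<open>A deterministic non-adaptive algorithm fixes its whole list of queries in advance; its output
  is a function of the list of answers alone. There is no computability or running-time
  requirement: the only cost is the number of queries.\<close>

datatype 'a nonadaptive_alg =
  Nonadaptive_Alg (queries: "'a set list") (reconstruct: "'a set set list \<Rightarrow> 'a set set")

definition run_alg :: "'a nonadaptive_alg \<Rightarrow> 'a set set \<Rightarrow> 'a set set" where
  "run_alg A E = reconstruct A (map (cc_oracle E) (queries A))"

definition num_queries :: "'a nonadaptive_alg \<Rightarrow> nat" where
  "num_queries A = length (queries A)"

definition solves_GR :: "'a set \<Rightarrow> nat \<Rightarrow> 'a nonadaptive_alg \<Rightarrow> bool" where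
  "solves_GR V \<Delta> A \<longleftrightarrow>
     (\<forall>S \<in> set (queries A). S \<subseteq> V) \<and>
     (\<forall>E. simple_graph V E \<and> max_degree V E = \<Delta> \<longrightarrow> run_alg A E = E)"

end

theory Submission
  imports Defs "HOL-Library.FuncSet"
begin

text \<open>A query \<open>S\<close> that contains \<open>u\<close> and \<open>v\<close> but no neighbour of \<open>u\<close> isolates \<open>u\<close> and hence
  certifies that \<open>{u, v}\<close> is not an edge, whereas the two ends of an edge are never separated by a
  query. So it suffices to have a family of queries such that for all \<open>u \<noteq> v\<close> and all sets \<open>T\<close>
  of at most \<open>\<Delta>\<close> other vertices some query contains \<open>u\<close> and \<open>v\<close> and avoids \<open>T\<close>.
  If \<open>n \<le> 4\<Delta>\<close>, the family of all pairs is small enough. Otherwise a random query that contains each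
  vertex with probability \<open>1 / (\<Delta> + 1)\<close> is good for a given triple \<open>(u, v, T)\<close> with
  probability at least \<open>1 / (12 \<Delta>\<^sup>2)\<close>, and there are at most \<open>exp (6 \<Delta> ln (n / \<Delta>))\<close>
  triples, so \<open>O(\<Delta>\<^sup>3 ln (n / \<Delta>))\<close> queries serve them all.\<close>

section \<open>Separating query families and the decoding rule\<close>

definition separating :: "'a set \<Rightarrow> nat \<Rightarrow> 'a set list \<Rightarrow> bool" where
  "separating V d Q \<longleftrightarrow>
     (\<forall>u\<in>V. \<forall>v\<in>V. \<forall>T. u \<noteq> v \<and> T \<subseteq> V - {u, v} \<and> card T \<le> d \<longrightarrow>
        (\<exists>S\<in>set Q. u \<in> S \<and> v \<in> S \<and> S \<inter> T = {}))"

text \<open>The decoder sees the answers only, so it recovers each query as the union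
  \<open>\<Union>p\<close> of the blocks of its answer \<open>p\<close>.\<close>

definition unseparated_pairs :: "'a set \<Rightarrow> 'a set set list \<Rightarrow> 'a set set" where
  "unseparated_pairs V P =
     {e. e \<subseteq> V \<and> card e = 2 \<and> (\<forall>p\<in>set P. e \<subseteq> \<Union>p \<longrightarrow> (\<exists>c\<in>p. e \<subseteq> c))}"

section \<open>Correctness of decoding\<close>

lemma equiv_induced_connected: "equiv S (induced_connected E S)"
proof (rule equivI)
  have "sym (induced_adj E S)"
    by (auto simp: sym_def induced_adj_def insert_commute)
  then have "sym ((induced_adj E S)\<^sup>*)"
    by (rule sym_rtrancl)
  then show "sym (induced_connected E S)"
    by (auto simp: sym_def induced_connected_def)
  show "refl_on S (induced_connected E S)"
    by (auto simp: refl_on_def induced_connected_def)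
  show "trans (induced_connected E S)"
    by (auto simp: trans_def induced_connected_def)
qed (auto simp: induced_connected_def)

lemma Union_cc_oracle: "\<Union>(cc_oracle E S) = S"
  unfolding cc_oracle_def by (rule Union_quotient[OF equiv_induced_connected])

lemma in_cc_oracle_iff:
  assumes "u \<in> S" "v \<in> S"
  shows "(\<exists>c\<in>cc_oracle E S. {u, v} \<subseteq> c) \<longleftrightarrow> (u, v) \<in> induced_connected E S"
proof
  assume "\<exists>c\<in>cc_oracle E S. {u, v} \<subseteq> c"
  then show "(u, v) \<in> induced_connected E S"
    unfolding cc_oracle_def using in_quotient_imp_in_rel[OF equiv_induced_connected] by metis
next
  assume *: "(u, v) \<in> induced_connected E S"
  have "(u, u) \<in> induced_connected E S"
    using assms by (auto simp: induced_connected_def)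
  with * have "{u, v} \<subseteq> induced_connected E S `` {u}"
    by auto
  then show "\<exists>c\<in>cc_oracle E S. {u, v} \<subseteq> c"
    unfolding cc_oracle_def using assms(1) by (meson quotientI)
qed

lemma finite_edges:
  assumes "simple_graph V E"
  shows "finite E"
proof (rule finite_subset)
  show "E \<subseteq> Pow V" and "finite (Pow V)"
    using assms by (auto simp: simple_graph_def)
qed

text \<open>Degrees count edges, while \<open>separating\<close> speaks of vertex sets; the
  injection \<open>w\<close> to \<open>{u, w}\<close> passes from one to the other.\<close>

lemma card_neighbours_le:
  assumes E: "simple_graph V E" and u: "u \<in> V"
  shows "card {w. {u, w} \<in> E} \<le> max_degree V E"
proof -
  have "card {w. {u, w} \<in> E} \<le> vertex_degree E u"
    unfolding vertex_degree_def
  proof (rule card_inj_on_le)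
    show "inj_on (\<lambda>w. {u, w}) {w. {u, w} \<in> E}"
      by (auto simp: inj_on_def doubleton_eq_iff)
    show "finite {e \<in> E. u \<in> e}"
      using finite_edges[OF E] by simp
  qed auto
  also have "\<dots> \<le> max_degree V E"
    unfolding max_degree_def using E u by (intro Max_ge) (auto simp: simple_graph_def)
  finally show ?thesis .
qed

lemma unseparated_pairs_eq_edges:
  assumes Q: "separating V d Q" and E: "simple_graph V E" "max_degree V E \<le> d"
  shows "unseparated_pairs V (map (cc_oracle E) Q) = E"
proof (intro set_eqI iffI)
  fix e assume e: "e \<in> E"
  then have "e \<subseteq> V" "card e = 2"
    using E(1) by (auto simp: simple_graph_def)
  moreover have "\<exists>c\<in>cc_oracle E S. e \<subseteq> c" if "e \<subseteq> S" for S
  proof -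
    obtain u v where uv: "e = {u, v}"
      using \<open>card e = 2\<close> by (auto simp: card_2_iff)
    then have "(u, v) \<in> induced_connected E S"
      using that e by (auto simp: induced_connected_def induced_adj_def)
    then show ?thesis
      using that uv in_cc_oracle_iff[of u S v E] by simp
  qed
  ultimately show "e \<in> unseparated_pairs V (map (cc_oracle E) Q)"
    by (auto simp: unseparated_pairs_def Union_cc_oracle)
next
  fix e assume e: "e \<in> unseparated_pairs V (map (cc_oracle E) Q)"
  then obtain u v where uv: "e = {u, v}" "u \<noteq> v" "u \<in> V" "v \<in> V"
    by (auto simp: unseparated_pairs_def card_2_iff)
  show "e \<in> E"
  proof (rule ccontr)
    assume "e \<notin> E"
    \<comment> \<open>The neighbourhood of \<open>u\<close> is an admissible set \<open>T\<close>:
      it misses \<open>v\<close> exactly because \<open>{u, v}\<close> is assumed not to be an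
      edge.\<close>
    define N where "N = {w. {u, w} \<in> E}"
    have "w \<in> V - {u, v}" if "w \<in> N" for w
      using that E(1) uv \<open>e \<notin> E\<close> by (auto simp: N_def simple_graph_def)
    moreover have "card N \<le> d"
      using card_neighbours_le[OF E(1) uv(3)] E(2) by (simp add: N_def)
    ultimately obtain S where S: "S \<in> set Q" "u \<in> S" "v \<in> S" "S \<inter> N = {}"
      using Q uv(2-4) unfolding separating_def by (meson subsetI)
    then have "(u, v) \<in> induced_connected E S"
      using e in_cc_oracle_iff[of u S v E] uv
      by (auto simp: unseparated_pairs_def Union_cc_oracle)
    then have "(u, v) \<in> (induced_adj E S)\<^sup>*"
      by (simp add: induced_connected_def)
    \<comment> \<open>A path from \<open>u\<close> to a different vertex starts with an edge at
      \<open>u\<close>, whose other end would lie in both \<open>S\<close> and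
      \<open>N\<close>.\<close>
    with \<open>u \<noteq> v\<close> obtain w where "(u, w) \<in> induced_adj E S"
      by (meson converse_rtranclE)
    with S show False
      by (auto simp: N_def induced_adj_def)
  qed
qed

section \<open>Greedy derandomisation\<close>

text \<open>Counting the pairs \<open>(f, x)\<close> with \<open>R f x\<close> and \<open>x\<close>
  not yet hit in two ways shows that some \<open>f\<close> hits at least a fraction \<open>p\<close>
  of the remaining elements. Taking such an \<open>f\<close> each time shrinks the remainder by a
  factor of at most \<open>1 - p\<close>.\<close>

lemma greedy_hitting_list:
  fixes R :: "'f \<Rightarrow> 'x \<Rightarrow> bool" and p :: real
  assumes F: "finite F" "F \<noteq> {}" and X: "finite X" and p: "p \<le> 1"
    and R: "\<And>x. x \<in> X \<Longrightarrow> p * card F \<le> card {f \<in> F. R f x}"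
  shows "\<exists>fs. set fs \<subseteq> F \<and> length fs = m \<and>
           card {x \<in> X. \<forall>f\<in>set fs. \<not> R f x} \<le> (1 - p) ^ m * card X"
proof (induction m)
  case 0
  show ?case by simp
next
  case (Suc m)
  then obtain fs where fs: "set fs \<subseteq> F" "length fs = m"
      "card {x \<in> X. \<forall>f\<in>set fs. \<not> R f x} \<le> (1 - p) ^ m * card X"
    by blast
  define Y where "Y = {x \<in> X. \<forall>f\<in>set fs. \<not> R f x}"
  have Y: "finite Y" "Y \<subseteq> X"
    using X by (auto simp: Y_def)
  have "(\<Sum>f\<in>F. p * card Y) = (\<Sum>x\<in>Y. p * card F)"
    by simp
  also have "\<dots> \<le> (\<Sum>x\<in>Y. real (card {f \<in> F. R f x}))"
    using R Y by (intro sum_mono) auto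
  also have "\<dots> = (\<Sum>x\<in>Y. \<Sum>f\<in>F. of_bool (R f x))"
    using F by (simp add: Int_def)
  also have "\<dots> = (\<Sum>f\<in>F. \<Sum>x\<in>Y. of_bool (R f x))"
    by (rule sum.swap)
  also have "\<dots> = (\<Sum>f\<in>F. real (card {x \<in> Y. R f x}))"
    using Y by (simp add: Int_def)
  \<comment> \<open>If every \<open>f\<close> hit fewer than \<open>p * card Y\<close> elements, the
    sum over the nonempty \<open>F\<close> would be too small.\<close>
  finally obtain f where f: "f \<in> F" "p * card Y \<le> card {x \<in> Y. R f x}"
    using F sum_strict_mono[of F "\<lambda>f. real (card {x \<in> Y. R f x})" "\<lambda>_. p * card Y"]
    by (meson not_le)
  have "{x \<in> X. \<forall>g\<in>set (f # fs). \<not> R g x} = Y - {x \<in> Y. R f x}"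
    by (auto simp: Y_def)
  then have "real (card {x \<in> X. \<forall>g\<in>set (f # fs). \<not> R g x}) = card Y - real (card {x \<in> Y. R f x})"
    using Y by (simp add: card_Diff_subset of_nat_diff card_mono)
  also have "\<dots> \<le> (1 - p) * card Y"
    using f by (simp add: algebra_simps)
  also have "\<dots> \<le> (1 - p) * ((1 - p) ^ m * card X)"
    using fs(3) p by (intro mult_left_mono) (auto simp: Y_def)
  finally have "card {x \<in> X. \<forall>g\<in>set (f # fs). \<not> R g x} \<le> (1 - p) ^ Suc m * card X"
    by (simp add: mult.assoc)
  with f fs show ?case
    by (intro exI[of _ "f # fs"]) simp
qed

section \<open>Success probability of a random query and a binomial bound\<close>

text \<open>A uniform \<open>f\<close> into \<open>{..d}\<close> encodes the random query
  \<open>{x. f x = 0}\<close>, so probabilities become cardinalities. The event is a product set: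
  \<open>{0}\<close> on \<open>A\<close>, \<open>{1..d}\<close> on \<open>T\<close>, everything
  elsewhere.\<close>

lemma card_random_query:
  assumes V: "finite V" and AT: "A \<subseteq> V" "T \<subseteq> V" "A \<inter> T = {}"
  shows "real (card {f \<in> V \<rightarrow>\<^sub>E {..d}. (\<forall>x\<in>A. f x = 0) \<and> (\<forall>x\<in>T. f x \<noteq> (0::nat))}) =
           (1 / (1 + real d)) ^ card A * (real d / (1 + real d)) ^ card T * card (V \<rightarrow>\<^sub>E {..d})"
proof -
  define B where "B x = (if x \<in> A then {0} else if x \<in> T then {1..d} else {..d})" for x
  have B: "B x \<subseteq> {..d}" for x
    by (auto simp: B_def)
  have "{f \<in> V \<rightarrow>\<^sub>E {..d}. (\<forall>x\<in>A. f x = 0) \<and> (\<forall>x\<in>T. f x \<noteq> 0)} = Pi\<^sub>E V B" (is "?L = _")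
  proof (intro set_eqI iffI)
    fix f assume "f \<in> ?L"
    then show "f \<in> Pi\<^sub>E V B"
      by (auto simp: PiE_iff B_def Suc_le_eq)
  next
    fix f assume f: "f \<in> Pi\<^sub>E V B"
    have "f x = 0" if "x \<in> A" for x
      using that AT PiE_mem[OF f, of x] by (auto simp: B_def)
    moreover have "f x \<noteq> 0" if "x \<in> T" for x
    proof -
      have "x \<in> V" "x \<notin> A"
        using that AT by auto
      then show ?thesis
        using that PiE_mem[OF f, of x] by (simp add: B_def)
    qed
    moreover have "f \<in> V \<rightarrow>\<^sub>E {..d}"
      using f PiE_mono[of V B "\<lambda>_. {..d}"] B by blast
    ultimately show "f \<in> ?L"
      by blast
  qed
  then have "real (card ?L) = (\<Prod>x\<in>V. real (card (B x)))"
    using V by (simp add: card_PiE)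
  \<comment> \<open>A factor \<open>1 + d\<close> is taken out at every vertex, leaving the
    probability of that vertex's constraint.\<close>
  also have "\<dots> = (\<Prod>x\<in>V. (if x \<in> A then 1 / (1 + real d) else 1) *
      (if x \<in> T then real d / (1 + real d) else 1) * (1 + real d))"
    using AT by (intro prod.cong) (auto simp: B_def)
  also have "\<dots> = (\<Prod>x\<in>V. if x \<in> A then 1 / (1 + real d) else 1) *
      (\<Prod>x\<in>V. if x \<in> T then real d / (1 + real d) else 1) * (1 + real d) ^ card V"
    by (simp add: prod.distrib)
  also have "\<dots> = (1 / (1 + real d)) ^ card A * (real d / (1 + real d)) ^ card T * (1 + real d) ^ card V"
  proof -
    have "V \<inter> A = A" "V \<inter> T = T"
      using AT by auto
    then show ?thesis
      using V by (simp add: prod.If_cases Int_def[symmetric])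
  qed
  also have "(1 + real d) ^ card V = card (V \<rightarrow>\<^sub>E {..d})"
    using V by (simp add: card_PiE)
  finally show ?thesis .
qed

text \<open>The constant 12 is 4 times 3, from \<open>1 + d <= 2 * d\<close> squared and from
  \<open>(1 + 1 / d) ^ d <= exp 1 <= 3\<close>.\<close>

lemma random_query_probability_ge:
  assumes "0 < d"
  shows "1 / (12 * real d ^ 2) \<le> (1 / (1 + real d)) ^ 2 * (real d / (1 + real d)) ^ d"
proof -
  have "(1 + 1 / real d) ^ d \<le> exp 1"
    using assms exp_ge_one_plus_x_over_n_power_n[of d 1] by simp
  then have "(1 + 1 / real d) ^ d \<le> 3"
    using exp_le by linarith
  moreover have "(1 + real d) ^ 2 \<le> (2 * real d) ^ 2"
    using assms by (intro power_mono) auto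
  ultimately have "(1 + real d) ^ 2 * (1 + 1 / real d) ^ d \<le> 4 * real d ^ 2 * 3"
    by (intro mult_mono) (auto simp: power_mult_distrib)
  moreover have "(1 / (1 + real d)) ^ 2 * (real d / (1 + real d)) ^ d =
      1 / ((1 + real d) ^ 2 * (1 + 1 / real d) ^ d)"
  proof -
    have "real d / (1 + real d) = 1 / (1 + 1 / real d)"
      using assms by (simp add: field_simps)
    then show ?thesis
      by (simp add: power_one_over)
  qed
  moreover have "0 < (1 + real d) ^ 2 * (1 + 1 / real d) ^ d"
    using assms by (intro mult_pos_pos zero_less_power) (auto simp: add_pos_nonneg)
  ultimately show ?thesis
    by (simp add: frac_le)
qed

text \<open>Keep only the \<open>k\<close>-th term of the binomial expansion of \<open>(1 + k / n) ^ n \<le> exp k\<close>.\<close>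

lemma binomial_le_exp:
  assumes "0 < k" "k \<le> n"
  shows "real (n choose k) \<le> exp (k * (1 + ln (real n / real k)))"
proof -
  have "real (n choose k) * (real k / real n) ^ k \<le>
      (\<Sum>i\<le>n. real (n choose i) * (real k / real n) ^ i * 1 ^ (n - i))"
    using assms member_le_sum[of k "{..n}" "\<lambda>i. real (n choose i) * (real k / real n) ^ i * 1 ^ (n - i)"]
    by simp
  also have "\<dots> = (1 + real k / real n) ^ n"
    using binomial_ring[of "real k / real n" 1 n] by (simp add: add.commute)
  also have "\<dots> \<le> exp (real k)"
    using assms by (intro exp_ge_one_plus_x_over_n_power_n) auto
  finally have "real (n choose k) * (real k / real n) ^ k \<le> exp (real k)" .
  moreover have "(real n / real k) ^ k * (real k / real n) ^ k = 1"
    using assms by (simp flip: power_mult_distrib)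
  ultimately have "real (n choose k) \<le> exp (real k) * (real n / real k) ^ k"
    using assms by (simp add: field_simps)
  also have "(real n / real k) ^ k = exp (k * ln (real n / real k))"
    using assms by (simp add: exp_of_nat_mult)
  finally show ?thesis
    by (simp add: distrib_left exp_add)
qed

section \<open>Construction of separating families\<close>

lemma separating_pairs:
  assumes V: "finite V"
  obtains Q where "\<forall>S\<in>set Q. S \<subseteq> V" "separating V d Q" "length Q \<le> (card V)\<^sup>2"
proof -
  define P where "P = (\<lambda>(u, v). {u, v}) ` (V \<times> V)"
  have "finite P"
    using V by (simp add: P_def)
  then obtain Q where Q: "set Q = P" "length Q = card P"
    using finite_distinct_list distinct_card by metis
  show ?thesis
  proof
    show "\<forall>S\<in>set Q. S \<subseteq> V"
      by (auto simp: Q P_def)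
    show "separating V d Q"
      unfolding separating_def
    proof (intro ballI allI impI bexI conjI)
      fix u v T assume "u \<in> V" "v \<in> V" "u \<noteq> v \<and> T \<subseteq> V - {u, v} \<and> card T \<le> d"
      then show "{u, v} \<inter> T = {}" "{u, v} \<in> set Q"
        by (auto simp: Q P_def)
    qed auto
    show "length Q \<le> (card V)\<^sup>2"
      using card_image_le[of "V \<times> V" "\<lambda>(u, v). {u, v}"] V
      by (simp add: Q P_def card_cartesian_product power2_eq_square)
  qed
qed

text \<open>The assumption \<open>4 * d < card V\<close> serves twice: it gives
  \<open>ln (n / d) >= 1\<close>, which absorbs lower-order terms, and it leaves at least
  \<open>d\<close> vertices besides \<open>u\<close> and \<open>v\<close>.\<close>

lemma separating_random:
  assumes V: "finite V" and d: "0 < d" "4 * d < card V"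
  obtains Q where "\<forall>S\<in>set Q. S \<subseteq> V" "separating V d Q"
    "length Q \<le> 74 * (real d ^ 3 * ln (real (card V) / real d))"
proof -
  define n where "n = card V"
  define L where "L = ln (real n / real d)"
  define p where "p = 1 / (12 * real d ^ 2)"
  define F where "F = (V \<rightarrow>\<^sub>E {..d})"
  \<comment> \<open>Only sets \<open>T\<close> of size exactly \<open>d\<close> are counted; smaller
    ones are enlarged at the end.\<close>
  define X where "X = {(u, v, T). u \<in> V \<and> v \<in> V \<and> u \<noteq> v \<and> T \<subseteq> V - {u, v} \<and> card T = d}"
  define R where "R f x = (case x of (u, v, T) \<Rightarrow> f u = 0 \<and> f v = 0 \<and> (\<forall>w\<in>T. f w \<noteq> (0::nat)))"
    for f :: "'a \<Rightarrow> nat" and x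
  \<comment> \<open>Chosen so that
    \<open>(1 - p) ^ m * card X <= exp (6 * d * L - p * m) < 1\<close>; the added 1 makes the last
    inequality strict.\<close>
  define m where "m = nat \<lceil>6 * d * L / p\<rceil> + 1"
  have n: "4 * d < n" "1 \<le> d"
    using d by (auto simp: n_def)
  have "3 \<le> real n / real d"
    using n by (simp add: field_simps)
  then have "exp 1 \<le> real n / real d"
    using exp_le by linarith
  then have L1: "1 \<le> L"
    unfolding L_def using n by (subst ln_ge_iff) auto
  have F: "finite F" "F \<noteq> {}"
    using V by (auto simp: F_def PiE_eq_empty_iff intro: finite_PiE)
  have X_sub: "X \<subseteq> V \<times> V \<times> {T. T \<subseteq> V \<and> card T = d}"
    by (auto simp: X_def)
  have X_fin: "finite (V \<times> V \<times> {T. T \<subseteq> V \<and> card T = d})"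
    using V by simp
  have X: "finite X"
    using X_sub X_fin by (rule finite_subset)
  have "1 \<le> real d ^ 2"
    using n by simp
  then have "1 \<le> 12 * real d ^ 2"
    by linarith
  then have p: "0 < p" "p \<le> 1"
    using n by (auto simp: p_def)
  have card_X: "card X \<le> exp (6 * d * L)"
  proof -
    have "card X \<le> n * (n * (n choose d))"
      using card_mono[OF X_fin X_sub] V by (simp add: card_cartesian_product n_subsets n_def)
    then have "real (card X) \<le> real n * (real n * real (n choose d))"
      by (metis of_nat_le_iff of_nat_mult)
    also have "\<dots> \<le> exp (ln n) * (exp (ln n) * exp (d * (1 + L)))"
      using n binomial_le_exp[of d n] by (simp add: L_def)
    also have "\<dots> = exp (2 * ln n + d * (1 + L))"
      by (simp add: exp_add[symmetric])
    also have "2 * ln n + d * (1 + L) \<le> 6 * d * L"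
    \<comment> \<open>From \<open>ln n <= L + d\<close> the left side is at most
      \<open>2 * L + 3 * d + d * L\<close>, and both \<open>L\<close> and \<open>d\<close> are at
      most \<open>d * L\<close>.\<close>
    proof -
      have "ln (real n) = L + ln (real d)"
        using n by (simp add: L_def ln_div)
      also have "ln (real d) \<le> d"
        using n ln_le_minus_one[of "real d"] by simp
      finally have "ln (real n) \<le> L + d"
        by simp
      moreover have "L \<le> d * L" "d \<le> d * L"
        using n L1 by auto
      ultimately have "2 * ln (real n) + d + d * L \<le> 6 * (d * L)"
        by linarith
      then show ?thesis
        by (simp add: distrib_left)
    qed
    finally show ?thesis
      by simp
  qed
  have R: "p * card F \<le> card {f \<in> F. R f x}" if x: "x \<in> X" for x
  proof -
    obtain u v T where uvT: "x = (u, v, T)" "u \<in> V" "v \<in> V" "u \<noteq> v" "T \<subseteq> V - {u, v}" "card T = d"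
      using x by (auto simp: X_def)
    have "p * card F \<le> (1 / (1 + real d)) ^ 2 * (real d / (1 + real d)) ^ d * card F"
      using random_query_probability_ge[of d] d by (intro mult_right_mono) (auto simp: p_def)
    also have "\<dots> = card {f \<in> F. (\<forall>x\<in>{u, v}. f x = 0) \<and> (\<forall>x\<in>T. f x \<noteq> 0)}"
      unfolding F_def using uvT by (subst card_random_query[OF V]) (auto simp: power2_eq_square)
    also have "{f \<in> F. (\<forall>x\<in>{u, v}. f x = 0) \<and> (\<forall>x\<in>T. f x \<noteq> 0)} = {f \<in> F. R f x}"
      by (auto simp: R_def uvT(1))
    finally show ?thesis .
  qed
  obtain fs where fs: "length fs = m"
      "card {x \<in> X. \<forall>f\<in>set fs. \<not> R f x} \<le> (1 - p) ^ m * card X"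
    using greedy_hitting_list[where R = R and m = m, OF F X p(2) R] by blast
  have "0 \<le> 6 * d * L / p"
    using p L1 by simp
  then have m: "6 * d * L / p < m" "m \<le> 6 * d * L / p + 2"
    unfolding m_def by linarith+
  have "(1 - p) ^ m * card X \<le> exp (- p) ^ m * exp (6 * d * L)"
    using card_X p exp_ge_add_one_self[of "- p"] by (intro mult_mono power_mono) auto
  also have "\<dots> = exp (6 * d * L - p * m)"
    by (simp add: exp_of_nat_mult[symmetric] exp_add[symmetric] mult.commute)
  also have "\<dots> < 1"
    using m(1) p by (simp add: field_simps)
  \<comment> \<open>A natural number below 1 is 0, so no triple is left unserved.\<close>
  finally have "card {x \<in> X. \<forall>f\<in>set fs. \<not> R f x} = 0"
    using fs(2) by linarith
  then have "{x \<in> X. \<forall>f\<in>set fs. \<not> R f x} = {}"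
    by (simp only: card_0_eq[OF finite_subset[OF Collect_restrict X]])
  then have hit: "\<exists>f\<in>set fs. R f x" if "x \<in> X" for x
    using that by blast
  define Q where "Q = map (\<lambda>f. {x \<in> V. f x = 0}) fs"
  show ?thesis
  proof
    show "\<forall>S\<in>set Q. S \<subseteq> V"
      by (auto simp: Q_def)
    show "separating V d Q"
      unfolding separating_def
    proof (intro ballI allI impI)
      fix u v T assume uv: "u \<in> V" "v \<in> V" and T: "u \<noteq> v \<and> T \<subseteq> V - {u, v} \<and> card T \<le> d"
      have "card (V - {u, v}) = n - 2"
        using uv T V by (simp add: card_Diff_subset n_def)
      then have "d \<le> card (V - {u, v})"
        using n by simp
      then obtain T' where T': "T \<subseteq> T'" "T' \<subseteq> V - {u, v}" "card T' = d"
        using exists_subset_between[of T d "V - {u, v}"] T V by auto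
      then obtain f where "f \<in> set fs" "R f (u, v, T')"
        using hit[of "(u, v, T')"] uv T by (auto simp: X_def)
      then show "\<exists>S\<in>set Q. u \<in> S \<and> v \<in> S \<and> S \<inter> T = {}"
        using uv T'(1) by (intro bexI[of _ "{x \<in> V. f x = 0}"]) (fastforce simp: Q_def R_def)+
    qed
    have "1 \<le> real d ^ 3"
      using n by simp
    then have "1 * 1 \<le> real d ^ 3 * L"
      using L1 by (intro mult_mono) auto
    \<comment> \<open>The 72 is 6 times the 12 in \<open>p\<close>; rounding in \<open>m\<close>
      costs at most 2 more, covered by \<open>d ^ 3 * L >= 1\<close>.\<close>
    moreover have "6 * d * L / p = 72 * (real d ^ 3 * L)"
      by (simp add: p_def power2_eq_square power3_eq_cube)
    ultimately have "m \<le> 74 * (real d ^ 3 * L)"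
      using m(2) by linarith
    then show "length Q \<le> 74 * (real d ^ 3 * ln (real (card V) / real d))"
      by (simp add: Q_def fs(1) L_def n_def)
  qed
qed

text \<open>For \<open>d\<close> close to \<open>n\<close> the logarithm tends to 0, but
  \<open>d < n\<close> still gives \<open>ln (n / d) >= 1 - d / n >= 1 / n\<close>. Together with
  \<open>n ^ 3 <= 64 * d ^ 3\<close> this pays for all pair queries.\<close>

lemma square_le_of_dense:
  assumes "d < n" "n \<le> 4 * d"
  shows "real n ^ 2 \<le> 74 * (real d ^ 3 * ln (real n / real d))"
proof -
  have "ln (real d / real n) \<le> real d / real n - 1"
    using assms by (intro ln_le_minus_one) auto
  moreover have "ln (real d / real n) = - ln (real n / real d)"
    using assms by (simp add: ln_div)
  moreover have "1 / real n \<le> 1 - real d / real n"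
    using assms by (simp add: field_simps)
  ultimately have ln: "1 / real n \<le> ln (real n / real d)"
    by linarith
  have "real n ^ 3 \<le> (4 * real d) ^ 3"
    using assms by (intro power_mono) auto
  also have "\<dots> \<le> 74 * real d ^ 3"
    by (simp add: power_mult_distrib)
  finally have "real n ^ 3 \<le> 74 * real d ^ 3" .
  then have "real n ^ 2 \<le> 74 * real d ^ 3 * (1 / real n)"
    using assms by (simp add: field_simps power2_eq_square power3_eq_cube)
  also have "\<dots> \<le> 74 * real d ^ 3 * ln (real n / real d)"
    using ln by (intro mult_left_mono) auto
  finally show ?thesis
    by (simp add: mult.assoc)
qed

section \<open>Assembling the algorithm\<close>

lemma max_degree_zero_imp_no_edges:
  assumes "simple_graph V E" "max_degree V E = 0"
  shows "E = {}"
proof (rule ccontr)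
  assume "E \<noteq> {}"
  then obtain e where "e \<in> E"
    by blast
  moreover from this obtain u v where "e = {u, v}" "u \<in> V"
    using assms(1) by (fastforce simp: simple_graph_def card_2_iff)
  moreover from this have "card {w. {u, w} \<in> E} = 0"
    using card_neighbours_le[OF assms(1)] assms(2) by fastforce
  moreover have "finite {w. {u, w} \<in> E}"
    by (rule finite_subset[of _ V]) (use assms(1) in \<open>auto simp: simple_graph_def\<close>)
  ultimately show False
    by auto
qed

lemma exists_alg:
  fixes V :: "'a set"
  assumes V: "finite V" and d: "d < card V"
  shows "\<exists>A. solves_GR V d A \<and>
           real (num_queries A) \<le> 74 * (real d ^ 3 * ln (real (card V) / real d))"
proof (cases "d = 0")
  case True
  \<comment> \<open>For \<open>d = 0\<close> the bound is 0 because of the factor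
    \<open>d ^ 3\<close>, so the algorithm must answer without any query.\<close>
  then have "solves_GR V d (Nonadaptive_Alg [] (\<lambda>_. {}))"
    using max_degree_zero_imp_no_edges by (fastforce simp: solves_GR_def run_alg_def)
  with True show ?thesis
    by (intro exI[of _ "Nonadaptive_Alg [] (\<lambda>_. {})"]) (simp add: num_queries_def)
next
  case False
  obtain Q where Q: "\<forall>S\<in>set Q. S \<subseteq> V" "separating V d Q"
      "length Q \<le> 74 * (real d ^ 3 * ln (real (card V) / real d))"
  proof (cases "4 * d < card V")
    case True
    with V \<open>d \<noteq> 0\<close> show ?thesis
      using separating_random[of V d] that by auto
  next
    case False
    obtain Q where Q: "\<forall>S\<in>set Q. S \<subseteq> V" "separating V d Q" "length Q \<le> (card V)\<^sup>2"
      using separating_pairs[OF V] .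
    have "real (length Q) \<le> real (card V) ^ 2"
      using Q(3) by (metis of_nat_le_iff of_nat_power)
    also have "\<dots> \<le> 74 * (real d ^ 3 * ln (real (card V) / real d))"
      using False d by (intro square_le_of_dense) auto
    finally show ?thesis
      using Q(1,2) by (intro that)
  qed
  let ?A = "Nonadaptive_Alg Q (unseparated_pairs V)"
  have "solves_GR V d ?A"
    using Q unseparated_pairs_eq_edges[OF Q(2)] by (auto simp: solves_GR_def run_alg_def)
  with Q(3) show ?thesis
    by (intro exI[of _ ?A]) (simp add: num_queries_def)
qed

theorem theorem3:
  "\<exists>(alg :: 'a set \<Rightarrow> nat \<Rightarrow> 'a nonadaptive_alg) (C :: real). C > 0 \<and>
     (\<forall>(V :: 'a set) (n :: nat) (\<Delta> :: nat).
        finite V \<and> card V = n \<and> \<Delta> < n \<longrightarrow>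
          solves_GR V \<Delta> (alg V \<Delta>) \<and>
          real (num_queries (alg V \<Delta>)) \<le> C * (real \<Delta> ^ 3 * ln (real n / real \<Delta>)))"
proof -
  \<comment> \<open>The constant 74 depends on neither \<open>V\<close> nor \<open>d\<close>, so
    choosing an algorithm for each pair keeps the bound uniform.\<close>
  obtain alg :: "'a set \<Rightarrow> nat \<Rightarrow> 'a nonadaptive_alg" where alg:
    "\<And>V d. finite V \<Longrightarrow> d < card V \<Longrightarrow> solves_GR V d (alg V d) \<and>
       real (num_queries (alg V d)) \<le> 74 * (real d ^ 3 * ln (real (card V) / real d))"
    using exists_alg by metis
  show ?thesis
    by (rule exI[of _ alg], rule exI[of _ 74]) (use alg in auto)
qed

end
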